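(* Let $\alpha_1, A_1, \alpha_2, A_2 > 0$ and consider the system of difference equations $$x_{n+1}=\frac{\alpha_{1}}{A_{1}+y_{n}},\qquad y_{n+1}=\frac{\alpha_{2}+x_{n}}{A_{2}+x_{n}},\qquad n=0,1,2,\dots,$$ with arbitrary nonnegative initial conditions $x_0,y_0$. There is a unique nonnegative equilibrium $(\bar x,\bar y)$, given by $$\bar{x}=\frac{\alpha_{1}-\alpha_{2}-A_{1}A_{2}+\sqrt{(\alpha_{1}-\alpha_{2}-A_{1}A_{2})^{2}+4\alpha_{1}A_{2}+4\alpha_{1}A_{1}A_{2}}}{2+2A_{1}},$$ $$\bar{y}=\frac{2\alpha_{1}+2\alpha_{1}A_{1}}{\alpha_{1}-\alpha_{2}-A_{1}A_{2}+\sqrt{(\alpha_{1}-\alpha_{2}-A_{1}A_{2})^{2}+4\alpha_{1}A_{2}+4\alpha_{1}A_{1}A_{2}}}-A_{1},$$ and it is globally asymptotically stable.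
   Context: The state space is $[0,\infty)^2$. A nonnegative equilibrium is a point $(\bar x,\bar y)\in[0,\infty)^2$ such that the constant sequence $(x_n,y_n)=(\bar x,\bar y)$ solves the system. It is globally asymptotically stable if it is Lyapunov stable relative to $[0,\infty)^2$ (for every $\varepsilon>0$ there is $\delta>0$ such that every initial condition in $[0,\infty)^2$ within $\delta$ of $(\bar x,\bar y)$ has its whole orbit within $\varepsilon$ of $(\bar x,\bar y)$) and every solution with initial condition in $[0,\infty)^2$ converges to $(\bar x,\bar y)$. *)

theory Defs
  imports "HOL-Analysis.Analysis"
begin

definition state_space :: "(real \<times> real) set" where
  "state_space = {0..} \<times> {0..}"

definition solves_system ::
  "real \<Rightarrow> real \<Rightarrow> real \<Rightarrow> real \<Rightarrow> (nat \<Rightarrow> real \<times> real) \<Rightarrow> bool" where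
  "solves_system \<alpha>1 A1 \<alpha>2 A2 z \<longleftrightarrow>
     (\<forall>n. fst (z (Suc n)) = \<alpha>1 / (A1 + snd (z n)) \<and>
          snd (z (Suc n)) = (\<alpha>2 + fst (z n)) / (A2 + fst (z n)))"

definition nonneg_equilibrium ::
  "real \<Rightarrow> real \<Rightarrow> real \<Rightarrow> real \<Rightarrow> real \<times> real \<Rightarrow> bool" where
  "nonneg_equilibrium \<alpha>1 A1 \<alpha>2 A2 p \<longleftrightarrow>
     p \<in> state_space \<and> solves_system \<alpha>1 A1 \<alpha>2 A2 (\<lambda>n. p)"

definition lyapunov_stable ::
  "real \<Rightarrow> real \<Rightarrow> real \<Rightarrow> real \<Rightarrow> real \<times> real \<Rightarrow> bool" where
  "lyapunov_stable \<alpha>1 A1 \<alpha>2 A2 p \<longleftrightarrow>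
     (\<forall>\<epsilon>>0. \<exists>\<delta>>0. \<forall>z. solves_system \<alpha>1 A1 \<alpha>2 A2 z \<longrightarrow> z 0 \<in> state_space \<longrightarrow>
        dist (z 0) p < \<delta> \<longrightarrow> (\<forall>n. dist (z n) p < \<epsilon>))"

definition globally_attracting ::
  "real \<Rightarrow> real \<Rightarrow> real \<Rightarrow> real \<Rightarrow> real \<times> real \<Rightarrow> bool" where
  "globally_attracting \<alpha>1 A1 \<alpha>2 A2 p \<longleftrightarrow>
     (\<forall>z. solves_system \<alpha>1 A1 \<alpha>2 A2 z \<longrightarrow> z 0 \<in> state_space \<longrightarrow> z \<longlonglongrightarrow> p)"

definition globally_asymptotically_stable ::
  "real \<Rightarrow> real \<Rightarrow> real \<Rightarrow> real \<Rightarrow> real \<times> real \<Rightarrow> bool" where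
  "globally_asymptotically_stable \<alpha>1 A1 \<alpha>2 A2 p \<longleftrightarrow>
     lyapunov_stable \<alpha>1 A1 \<alpha>2 A2 p \<and> globally_attracting \<alpha>1 A1 \<alpha>2 A2 p"

end

theory Submission imports Defs begin

text \<open>
  Two steps of the system act on the first coordinate as the Moebius map
  $T(x) = \alpha_1 (A_2 + x) / (a + b x)$ with $a = A_1 A_2 + \alpha_2$ and $b = 1 + A_1$. It has
  one positive fixed point $X$ and one negative fixed point $-q$, so it multiplies the ratio
  $(x - X) / (x + q)$ by a constant $\lambda$, and $|\lambda| < 1$. As $T$ is bounded on the
  half-line, $|x_{2n} - X| \le C |\lambda|^n |x_0 - X|$; the odd terms and the second coordinate
  follow by Lipschitz estimates for a single step. This exponential bound gives stability and
  attraction, and attraction forces uniqueness of the equilibrium.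
\<close>

section \<open>The two-step map: its fixed points and multiplier\<close>

text \<open>Stability needs only the equilibrium equations, cleared of denominators; the closed
  formulas enter when the locale is interpreted.\<close>

locale positive_equilibrium =
  fixes \<alpha>1 A1 \<alpha>2 A2 X Y :: real
  assumes pos: "\<alpha>1 > 0" "A1 > 0" "\<alpha>2 > 0" "A2 > 0"
    and XY_pos: "X > 0" "Y > 0"
    and equil: "X * (A1 + Y) = \<alpha>1" "Y * (A2 + X) = \<alpha>2 + X"
begin

text \<open>Minus the negative fixed point of the two-step map.\<close>

definition q :: real where
  "q = X + (A1 * A2 + \<alpha>2 - \<alpha>1) / (1 + A1)"

text \<open>This is the multiplier \<lambda>: \<open>T x - X\<close> and \<open>T x + q\<close>
  equal \<open>x - X\<close> and \<open>x + q\<close> times the numerator and denominator here, each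
  over the common denominator of \<open>T x\<close>.\<close>

definition rate :: real where
  "rate = (\<alpha>1 - (1 + A1) * X) / (\<alpha>1 + (1 + A1) * q)"

text \<open>Eliminating \<open>Y\<close> between the two equilibrium equations gives the fixed-point
  equation of \<open>T\<close>.\<close>

lemma fixed_point_quadratic: "(1 + A1) * X\<^sup>2 + (A1 * A2 + \<alpha>2 - \<alpha>1) * X = \<alpha>1 * A2"
proof -
  have "X * (A1 + Y) * (A2 + X) = \<alpha>1 * (A2 + X)"
    using equil(1) by simp
  moreover have "X * (A1 + Y) * (A2 + X) = X * A1 * (A2 + X) + X * (Y * (A2 + X))"
    by algebra
  ultimately show ?thesis
    unfolding equil(2) by (simp add: algebra_simps power2_eq_square)
qed

lemma q_eq: "(1 + A1) * q = (1 + A1) * X + (A1 * A2 + \<alpha>2 - \<alpha>1)"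
  using pos by (simp add: q_def distrib_left)

text \<open>Vieta: \<open>q\<close> was defined through the sum of the roots \<open>X\<close> and
  \<open>-q\<close>; their product reveals its sign.\<close>

lemma q_mult: "(1 + A1) * q * X = \<alpha>1 * A2"
  using fixed_point_quadratic q_eq by algebra

lemma q_pos: "q > 0"
proof -
  have "((1 + A1) * X) * q > 0"
    using q_mult pos by (simp add: mult_ac)
  moreover have "(1 + A1) * X > 0"
    using pos XY_pos by simp
  ultimately show ?thesis
    by (rule zero_less_mult_pos)
qed

lemma rate_less_1: "\<bar>rate\<bar> < 1"
proof -
  have "(1 + A1) * q > 0" "(1 + A1) * X > 0" "A1 * A2 > 0"
    using q_pos pos XY_pos by simp_all
  \<comment> \<open>By \<open>q_eq\<close>, the right side minus the unsigned left one is
    \<open>(1 + A1) * (q + X)\<close>, and their sum is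
    \<open>\<alpha>1 + \<alpha>2 + A1 * A2\<close>; both are positive.\<close>
  then have "\<bar>\<alpha>1 - (1 + A1) * X\<bar> < \<alpha>1 + (1 + A1) * q"
    using q_eq pos by linarith
  then show ?thesis
    by (simp add: rate_def)
qed

section \<open>Geometric convergence along two-step orbits\<close>

lemma two_step_ratio:
  assumes "x \<ge> 0" and t: "t = \<alpha>1 / (A1 + (\<alpha>2 + x) / (A2 + x))"
  shows "(t - X) * (x + q) = rate * (x - X) * (t + q)"
proof -
  \<comment> \<open>The denominator of \<open>T x\<close>; multiplying by it makes both factors of
    the ratio linear in \<open>x\<close>.\<close>
  define d where "d = A1 * (A2 + x) + (\<alpha>2 + x)"
  have d: "d > 0"
    using assms(1) pos by (simp add: d_def add_pos_pos add_pos_nonneg)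
  have "A1 + (\<alpha>2 + x) / (A2 + x) = d / (A2 + x)"
    using assms(1) pos by (simp add: d_def field_simps)
  then have td: "t * d = \<alpha>1 * (A2 + x)"
    using d t by simp
  have 1: "(t - X) * d = (\<alpha>1 - (1 + A1) * X) * (x - X)"
    using td fixed_point_quadratic by (simp add: d_def algebra_simps power2_eq_square)
  have 2: "(t + q) * d = (\<alpha>1 + (1 + A1) * q) * (x + q)"
  proof -
    have "(A1 * A2 + \<alpha>2) * q = ((1 + A1) * q - (1 + A1) * X + \<alpha>1) * q"
      using q_eq by simp
    then show ?thesis
      using td q_mult by (simp add: d_def algebra_simps)
  qed
  have nz: "\<alpha>1 + (1 + A1) * q > 0"
    using q_pos pos by (simp add: add_pos_pos)
  have "((t - X) * (x + q)) * d = (\<alpha>1 - (1 + A1) * X) * (x - X) * (x + q)"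
    using 1 by (simp add: mult_ac)
  also have "\<dots> = rate * (x - X) * ((\<alpha>1 + (1 + A1) * q) * (x + q))"
    using nz by (simp add: rate_def)
  also have "\<dots> = (rate * (x - X) * (t + q)) * d"
    by (simp flip: 2)
  finally show ?thesis
    using d by simp
qed

text \<open>An upper bound for \<open>(u n + q) / (u 0 + q)\<close> when
  \<open>0 \<le> u n \<le> \<alpha>1 / A1\<close> and \<open>u 0 \<ge> 0\<close>.\<close>

definition C :: real where
  "C = 1 + \<alpha>1 / A1 / q"

lemma C_ge_1: "C \<ge> 1"
  using pos q_pos by (simp add: C_def)

lemma iterated_two_step_bound:
  fixes u :: "nat \<Rightarrow> real"
  assumes u0: "u 0 \<ge> 0"
    and step: "\<And>n. u (Suc n) = \<alpha>1 / (A1 + (\<alpha>2 + u n) / (A2 + u n))"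
  shows "\<bar>u n - X\<bar> \<le> C * \<bar>rate\<bar> ^ n * \<bar>u 0 - X\<bar>"
proof -
  have nonneg: "u n \<ge> 0" for n
    by (induction n) (use u0 step pos in auto)
  have bounded: "u (Suc n) \<le> \<alpha>1 / A1" for n
    using step[of n] nonneg[of n] pos by (simp add: frac_le)
  \<comment> \<open>The ratio identity iterated in cross-multiplied form; the induction step cancels
    the positive factor \<open>u n + q\<close>.\<close>
  have ratio: "(u n - X) * (u 0 + q) = rate ^ n * (u 0 - X) * (u n + q)" for n
  proof (induction n)
    case (Suc n)
    have "((u (Suc n) - X) * (u 0 + q)) * (u n + q)
        = ((u (Suc n) - X) * (u n + q)) * (u 0 + q)"
      by algebra
    also have "\<dots> = rate * (u (Suc n) + q) * ((u n - X) * (u 0 + q))"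
      using two_step_ratio[OF nonneg step, of n] by algebra
    also have "\<dots> = (rate ^ Suc n * (u 0 - X) * (u (Suc n) + q)) * (u n + q)"
      unfolding Suc.IH by simp
    finally show ?case
      using nonneg[of n] q_pos by simp
  qed simp
  show ?thesis
  \<comment> \<open>Since \<open>u 0\<close> may exceed \<open>\<alpha>1 / A1\<close>, the bound on
    \<open>u n\<close> starts at index 1; index 0 rests on \<open>C \<ge> 1\<close>.\<close>
  proof (cases n)
    case 0
    then show ?thesis
      using mult_right_mono[OF C_ge_1, of "\<bar>u 0 - X\<bar>"] by simp
  next
    case (Suc m)
    have Cq: "C * q = \<alpha>1 / A1 + q"
      using q_pos pos by (simp add: C_def field_simps)
    have "\<bar>u n - X\<bar> * q \<le> \<bar>u n - X\<bar> * (u 0 + q)"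
      using u0 by (intro mult_left_mono) auto
    also have "\<dots> = \<bar>(u n - X) * (u 0 + q)\<bar>"
      using u0 q_pos by (simp add: abs_mult)
    also have "\<dots> = \<bar>rate\<bar> ^ n * \<bar>u 0 - X\<bar> * (u n + q)"
      using nonneg[of n] q_pos by (simp add: ratio abs_mult power_abs)
    also have "\<dots> \<le> \<bar>rate\<bar> ^ n * \<bar>u 0 - X\<bar> * (C * q)"
      using bounded[of m] Suc by (intro mult_left_mono) (simp_all add: Cq)
    finally have "\<bar>u n - X\<bar> * q \<le> (C * \<bar>rate\<bar> ^ n * \<bar>u 0 - X\<bar>) * q"
      by (simp add: mult_ac)
    then show ?thesis
      using q_pos by simp
  qed
qed

section \<open>From two-step orbits to the full system\<close>

lemma x_step_lipschitz:
  assumes "y \<ge> 0"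
  shows "\<bar>\<alpha>1 / (A1 + y) - X\<bar> \<le> X / A1 * \<bar>y - Y\<bar>"
proof -
  have "\<alpha>1 / (A1 + y) - X = X * (Y - y) / (A1 + y)"
    using assms pos equil(1) by (simp add: field_simps)
  then have "\<bar>\<alpha>1 / (A1 + y) - X\<bar> = X * \<bar>y - Y\<bar> / (A1 + y)"
    using assms pos XY_pos by (simp add: abs_mult abs_minus_commute)
  also have "\<dots> \<le> X * \<bar>y - Y\<bar> / A1"
    using assms pos XY_pos by (intro divide_left_mono) auto
  finally show ?thesis
    by simp
qed

lemma y_step_lipschitz:
  assumes "x \<ge> 0"
  shows "\<bar>(\<alpha>2 + x) / (A2 + x) - Y\<bar> \<le> \<bar>1 - Y\<bar> / A2 * \<bar>x - X\<bar>"
proof -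
  have "(\<alpha>2 + x) / (A2 + x) - Y = (1 - Y) * (x - X) / (A2 + x)"
    using assms pos equil(2) by (simp add: field_simps)
  then have "\<bar>(\<alpha>2 + x) / (A2 + x) - Y\<bar> = \<bar>1 - Y\<bar> * \<bar>x - X\<bar> / (A2 + x)"
    using assms pos by (simp add: abs_mult)
  also have "\<dots> \<le> \<bar>1 - Y\<bar> * \<bar>x - X\<bar> / A2"
    using assms pos by (intro divide_left_mono) auto
  finally show ?thesis
    by simp
qed

text \<open>\<open>K\<close> is uniform in the orbit and the bound is linear in the initial
  distance, so it serves both stability and attraction. The exponent reflects that the second
  coordinate at time \<open>n\<close> is controlled by the first at time \<open>n - 1\<close>; at
  \<open>n = 0\<close> truncated subtraction makes it 0.\<close>

lemma exponential_bound:
  obtains K where "K > 0"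
    and "\<And>z n. solves_system \<alpha>1 A1 \<alpha>2 A2 z \<Longrightarrow> z 0 \<in> state_space \<Longrightarrow>
           dist (z n) (X, Y) \<le> K * \<bar>rate\<bar> ^ ((n - 1) div 2) * dist (z 0) (X, Y)"
proof
  define k where "k = X / A1"
  define l where "l = \<bar>1 - Y\<bar> / A2"
  \<comment> \<open>The factor \<open>1 + k\<close> covers both possible starting terms,
    \<open>x 0\<close> and \<open>x 1\<close>. In \<open>K\<close>, the summands \<open>Kx\<close>
    and \<open>l * Kx\<close> serve the two coordinates, and 1 serves time 0.\<close>
  define Kx where "Kx = C * (1 + k)"
  define K where "K = Kx + l * Kx + 1"
  have k: "k \<ge> 0" and l: "l \<ge> 0"
    using pos XY_pos by (simp_all add: k_def l_def)
  have C: "C > 0"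
    using C_ge_1 by linarith
  have Kx: "Kx \<ge> 0"
    using k C by (simp add: Kx_def)
  show "K > 0"
    using Kx l by (simp add: K_def add_nonneg_pos)
  fix z :: "nat \<Rightarrow> real \<times> real" and n
  assume solves: "solves_system \<alpha>1 A1 \<alpha>2 A2 z" and init: "z 0 \<in> state_space"
  define x where "x i = fst (z i)" for i
  define y where "y i = snd (z i)" for i
  define D where "D = dist (z 0) (X, Y)"
  have D: "D \<ge> 0"
    by (simp add: D_def)
  have xS: "x (Suc i) = \<alpha>1 / (A1 + y i)" and yS: "y (Suc i) = (\<alpha>2 + x i) / (A2 + x i)" for i
    using solves by (simp_all add: solves_system_def x_def y_def)
  have nonneg: "x i \<ge> 0 \<and> y i \<ge> 0" for i
  proof (induction i)
    case 0
    show ?case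
      using init by (auto simp: x_def y_def state_space_def)
  qed (use pos in \<open>simp add: xS yS\<close>)
  have x0: "\<bar>x 0 - X\<bar> \<le> D"
    using dist_fst_le[of "z 0" "(X, Y)"] by (simp add: D_def x_def dist_real_def)
  have y0: "\<bar>y 0 - Y\<bar> \<le> D"
    using dist_snd_le[of "z 0" "(X, Y)"] by (simp add: D_def y_def dist_real_def)
  have x1: "\<bar>x 1 - X\<bar> \<le> k * D"
    using x_step_lipschitz[of "y 0"] nonneg[of 0] mult_left_mono[OF y0 k]
    by (simp add: xS k_def)
  have x_bound: "\<bar>x i - X\<bar> \<le> Kx * \<bar>rate\<bar> ^ (i div 2) * D" for i
  proof -
    \<comment> \<open>Terms of equal parity form an orbit of \<open>T\<close>.\<close>
    define r where "r = i mod 2"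
    define u where "u j = x (2 * j + r)" for j
    have "\<bar>u j - X\<bar> \<le> C * \<bar>rate\<bar> ^ j * \<bar>u 0 - X\<bar>" for j
    proof (rule iterated_two_step_bound)
      show "u 0 \<ge> 0"
        using nonneg by (simp add: u_def)
      show "u (Suc j) = \<alpha>1 / (A1 + (\<alpha>2 + u j) / (A2 + u j))" for j
        by (simp add: u_def xS yS)
    qed
    from this[of "i div 2"]
    have "\<bar>x i - X\<bar> \<le> C * \<bar>rate\<bar> ^ (i div 2) * \<bar>x r - X\<bar>"
      by (simp add: u_def r_def)
    also have "\<bar>x r - X\<bar> \<le> (1 + k) * D"
    proof -
      consider "r = 0" | "r = 1"
        unfolding r_def by linarith
      then show ?thesis
        using x0 x1 D mult_nonneg_nonneg[OF k D] by cases (auto simp: algebra_simps)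
    qed
    then have "C * \<bar>rate\<bar> ^ (i div 2) * \<bar>x r - X\<bar> \<le> C * \<bar>rate\<bar> ^ (i div 2) * ((1 + k) * D)"
      using C by (intro mult_left_mono) auto
    finally show ?thesis
      by (simp add: Kx_def mult_ac)
  qed
  have dist_le: "dist (z i) (X, Y) \<le> \<bar>x i - X\<bar> + \<bar>y i - Y\<bar>" for i
    using sqrt_sum_squares_le_sum_abs[of "x i - X" "y i - Y"]
    by (simp add: dist_prod_def dist_real_def x_def y_def)
  show "dist (z n) (X, Y) \<le> K * \<bar>rate\<bar> ^ ((n - 1) div 2) * dist (z 0) (X, Y)"
  proof (cases n)
    case 0
    have "Kx + l * Kx \<ge> 0"
      using Kx l by simp
    then have "1 * D \<le> K * D"
      using D by (intro mult_right_mono) (auto simp: K_def)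
    then show ?thesis
      by (simp add: 0 D_def)
  next
    case (Suc m)
    define p where "p = \<bar>rate\<bar> ^ (m div 2)"
    have p: "p \<ge> 0"
      by (simp add: p_def)
    have "\<bar>rate\<bar> ^ (n div 2) \<le> p"
      unfolding p_def Suc using rate_less_1 by (intro power_decreasing) auto
    then have "Kx * \<bar>rate\<bar> ^ (n div 2) * D \<le> Kx * p * D"
      using Kx D by (intro mult_right_mono mult_left_mono) auto
    with x_bound[of n] have xn: "\<bar>x n - X\<bar> \<le> Kx * p * D"
      by linarith
    have "\<bar>y n - Y\<bar> \<le> l * \<bar>x m - X\<bar>"
      using y_step_lipschitz[of "x m"] nonneg[of m] by (simp add: Suc yS l_def)
    also have "\<dots> \<le> l * (Kx * p * D)"
      using x_bound[of m] l by (intro mult_left_mono) (simp_all add: p_def)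
    finally have "dist (z n) (X, Y) \<le> Kx * p * D + l * (Kx * p * D)"
      using dist_le[of n] xn by linarith
    also have "\<dots> \<le> K * p * D"
      using p D by (simp add: K_def algebra_simps)
    finally show ?thesis
      by (simp add: Suc p_def D_def)
  qed
qed

section \<open>Stability, attraction and uniqueness\<close>

lemma lyapunov_stable: "lyapunov_stable \<alpha>1 A1 \<alpha>2 A2 (X, Y)"
  unfolding lyapunov_stable_def
proof (intro allI impI)
  fix \<epsilon> :: real
  assume \<epsilon>: "\<epsilon> > 0"
  obtain K where K: "K > 0"
    and bound: "\<And>z n. solves_system \<alpha>1 A1 \<alpha>2 A2 z \<Longrightarrow> z 0 \<in> state_space \<Longrightarrow>
           dist (z n) (X, Y) \<le> K * \<bar>rate\<bar> ^ ((n - 1) div 2) * dist (z 0) (X, Y)"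
    using exponential_bound by blast
  show "\<exists>\<delta>>0. \<forall>z. solves_system \<alpha>1 A1 \<alpha>2 A2 z \<longrightarrow> z 0 \<in> state_space \<longrightarrow>
          dist (z 0) (X, Y) < \<delta> \<longrightarrow> (\<forall>n. dist (z n) (X, Y) < \<epsilon>)"
  proof (intro exI[of _ "\<epsilon> / K"] conjI allI impI)
    show "\<epsilon> / K > 0"
      using \<epsilon> K by simp
    fix z :: "nat \<Rightarrow> real \<times> real" and n
    assume z: "solves_system \<alpha>1 A1 \<alpha>2 A2 z" "z 0 \<in> state_space"
      and near: "dist (z 0) (X, Y) < \<epsilon> / K"
    have "\<bar>rate\<bar> ^ ((n - 1) div 2) \<le> 1"
      using rate_less_1 by (intro power_le_one) auto
    then have "K * \<bar>rate\<bar> ^ ((n - 1) div 2) * dist (z 0) (X, Y) \<le> K * 1 * dist (z 0) (X, Y)"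
      using K by (intro mult_right_mono mult_left_mono) auto
    also have "\<dots> < \<epsilon>"
      using near K by (simp add: field_simps)
    finally show "dist (z n) (X, Y) < \<epsilon>"
      using bound[OF z, of n] by linarith
  qed
qed

lemma globally_attracting: "globally_attracting \<alpha>1 A1 \<alpha>2 A2 (X, Y)"
  unfolding globally_attracting_def
proof (intro allI impI)
  fix z :: "nat \<Rightarrow> real \<times> real"
  assume z: "solves_system \<alpha>1 A1 \<alpha>2 A2 z" "z 0 \<in> state_space"
  obtain K where bound:
    "\<And>n. dist (z n) (X, Y) \<le> K * \<bar>rate\<bar> ^ ((n - 1) div 2) * dist (z 0) (X, Y)"
    using exponential_bound z by metis
  have "filterlim (\<lambda>n::nat. (n - 1) div 2) at_top sequentially"
    unfolding filterlim_at_top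
  proof
    fix m :: nat
    show "\<forall>\<^sub>F n in sequentially. m \<le> (n - 1) div 2"
      using eventually_ge_at_top[of "2 * m + 1"] by eventually_elim linarith
  qed
  then have "(\<lambda>n. \<bar>rate\<bar> ^ ((n - 1) div 2)) \<longlonglongrightarrow> 0"
    using filterlim_compose[OF LIMSEQ_power_zero[of "\<bar>rate\<bar>"]] rate_less_1 by simp
  then have "(\<lambda>n. K * \<bar>rate\<bar> ^ ((n - 1) div 2) * dist (z 0) (X, Y)) \<longlonglongrightarrow> 0"
    by (intro tendsto_mult_left_zero tendsto_mult_right_zero)
  then have "(\<lambda>n. dist (z n) (X, Y)) \<longlonglongrightarrow> 0"
    by (rule tendsto_sandwich[OF always_eventually always_eventually tendsto_const, rotated 2])
      (use bound in simp_all)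
  then show "z \<longlonglongrightarrow> (X, Y)"
    by (subst tendsto_dist_iff)
qed

lemma nonneg_equilibrium: "nonneg_equilibrium \<alpha>1 A1 \<alpha>2 A2 (X, Y)"
proof -
  have "A1 + Y > 0" "A2 + X > 0"
    using pos XY_pos by simp_all
  then show ?thesis
    using equil XY_pos
    by (simp add: nonneg_equilibrium_def state_space_def solves_system_def field_simps)
qed

text \<open>A constant solution that converges to \<open>(X, Y)\<close> must equal it, so no second
  root analysis is required.\<close>

lemma nonneg_equilibrium_unique:
  assumes "nonneg_equilibrium \<alpha>1 A1 \<alpha>2 A2 p"
  shows "p = (X, Y)"
proof -
  have "(\<lambda>n::nat. p) \<longlonglongrightarrow> (X, Y)"
    using assms globally_attracting
    by (simp add: nonneg_equilibrium_def globally_attracting_def)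
  then show ?thesis
    by (simp add: LIMSEQ_const_iff)
qed

end

section \<open>The closed formulas\<close>

lemma quadratic_positive_root:
  fixes b c d :: real
  assumes "b > 0" "d > 0" and x: "x = (c + sqrt (c\<^sup>2 + 4 * b * d)) / (2 * b)"
  shows "x > 0" and "b * x\<^sup>2 = c * x + d"
proof -
  have "\<bar>c\<bar> < sqrt (c\<^sup>2 + 4 * b * d)"
    using assms(1,2) by (intro real_less_rsqrt) simp
  then show "x > 0"
    using assms(1) x by simp
  have "2 * b * x - c = sqrt (c\<^sup>2 + 4 * b * d)"
    using assms(1) x by simp
  then have "(2 * b * x - c)\<^sup>2 = c\<^sup>2 + 4 * b * d"
    using assms(1,2) by simp
  then have "(4 * b) * (b * x\<^sup>2) = (4 * b) * (c * x + d)"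
    by (simp add: power2_eq_square algebra_simps)
  then show "b * x\<^sup>2 = c * x + d"
    using assms(1) by simp
qed

theorem theorem17:
  fixes \<alpha>1 A1 \<alpha>2 A2 xbar ybar :: real
  assumes "\<alpha>1 > 0" and "A1 > 0" and "\<alpha>2 > 0" and "A2 > 0"
    and "xbar =
      (\<alpha>1 - \<alpha>2 - A1 * A2 + sqrt ((\<alpha>1 - \<alpha>2 - A1 * A2)\<^sup>2 + 4 * \<alpha>1 * A2 + 4 * \<alpha>1 * A1 * A2))
        / (2 + 2 * A1)"
    and "ybar =
      (2 * \<alpha>1 + 2 * \<alpha>1 * A1)
        / (\<alpha>1 - \<alpha>2 - A1 * A2 + sqrt ((\<alpha>1 - \<alpha>2 - A1 * A2)\<^sup>2 + 4 * \<alpha>1 * A2 + 4 * \<alpha>1 * A1 * A2))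
      - A1"
  shows "(\<exists>!p. nonneg_equilibrium \<alpha>1 A1 \<alpha>2 A2 p) \<and>
         nonneg_equilibrium \<alpha>1 A1 \<alpha>2 A2 (xbar, ybar) \<and>
         globally_asymptotically_stable \<alpha>1 A1 \<alpha>2 A2 (xbar, ybar)"
proof -
  define c where "c = \<alpha>1 - \<alpha>2 - A1 * A2"
  define s where "s = sqrt (c\<^sup>2 + 4 * \<alpha>1 * A2 + 4 * \<alpha>1 * A1 * A2)"
  have x_eq: "xbar = (c + s) / (2 + 2 * A1)"
    using assms(5) by (simp add: c_def s_def)
  have y_eq: "ybar = (2 * \<alpha>1 + 2 * \<alpha>1 * A1) / (c + s) - A1"
    using assms(6) by (simp add: c_def s_def)
  \<comment> \<open>Regrouping the discriminant shows the quadratic formula for the fixed-point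
    equation of \<open>T\<close>.\<close>
  have "xbar = (c + sqrt (c\<^sup>2 + 4 * (1 + A1) * (\<alpha>1 * A2))) / (2 * (1 + A1))"
    unfolding x_eq s_def by (simp add: algebra_simps)
  with quadratic_positive_root[of "1 + A1" "\<alpha>1 * A2" xbar c]
  have x_pos: "xbar > 0" and quad: "(1 + A1) * xbar\<^sup>2 = c * xbar + \<alpha>1 * A2"
    using assms(1-4) by simp_all
  have cs: "c + s = (2 + 2 * A1) * xbar"
    using assms(2) by (simp add: x_eq)
  have "ybar = (2 + 2 * A1) * \<alpha>1 / ((2 + 2 * A1) * xbar) - A1"
    unfolding y_eq cs by (simp add: algebra_simps)
  then have ybar: "ybar = \<alpha>1 / xbar - A1"
    using assms(2) by simp
  have eq1: "xbar * (A1 + ybar) = \<alpha>1"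
    using x_pos by (simp add: ybar)
  \<comment> \<open>Multiplied by \<open>xbar\<close>, the second equilibrium equation reduces via
    \<open>eq1\<close> to the quadratic \<open>quad\<close>.\<close>
  have "(ybar * (A2 + xbar)) * xbar = (xbar * (A1 + ybar) - A1 * xbar) * (A2 + xbar)"
    by algebra
  also have "\<dots> = (\<alpha>2 + xbar) * xbar"
    unfolding eq1 using quad by (simp add: c_def algebra_simps power2_eq_square)
  finally have eq2: "ybar * (A2 + xbar) = \<alpha>2 + xbar"
    using x_pos by simp
  \<comment> \<open>The sign of \<open>ybar\<close> is hidden in the difference
    \<open>\<alpha>1 / xbar - A1\<close>; \<open>eq2\<close> exposes it.\<close>
  then have "ybar * (A2 + xbar) > 0"
    using x_pos assms(3) by simp
  then have y_pos: "ybar > 0"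
    using x_pos assms(4) by (simp add: zero_less_mult_iff)
  interpret positive_equilibrium \<alpha>1 A1 \<alpha>2 A2 xbar ybar
    using assms(1-4) x_pos y_pos eq1 eq2 by unfold_locales
  show ?thesis
    unfolding globally_asymptotically_stable_def
    using nonneg_equilibrium nonneg_equilibrium_unique lyapunov_stable globally_attracting
    by blast
qed

end
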